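(* Let $X$ be a vector field of class $\mathcal{C}^{1}$ on $\mathbb{R}^{n}$. Let $b$ be a geometric structure on $\mathbb{R}^{n}$ (a nondegenerate real bilinear form), and let $(b,B)$ be the associated geometric pair. Then the following assertions hold. (i) $X=\nabla^{L}_{b}H$ for some $H\in\mathcal{C}^{2}(\mathbb{R}^{n},\mathbb{R})$ if and only if $$(\mathrm{D}X(\mathbf{x}))^{\top}B^{-1}=(B^{\star})^{-1}\mathrm{D}X(\mathbf{x}),\quad\forall\mathbf{x}\in\mathbb{R}^{n}.$$ Moreover, if $X$ satisfies this condition, then the solution of the equation $X=\nabla^{L}_{b}H$ is given by $H(\mathbf{x})=\int_{0}^{1}b(X(t\mathbf{x}),\mathbf{x})\,\mathrm{d}t+\text{constant}$, $\forall\mathbf{x}\in\mathbb{R}^{n}$. (ii) $X=\nabla^{R}_{b}H$ for some $H\in\mathcal{C}^{2}(\mathbb{R}^{n},\mathbb{R})$ if and only if $$(\mathrm{D}X(\mathbf{x}))^{\top}(B^{\star})^{-1}=B^{-1}\mathrm{D}X(\mathbf{x}),\quad\forall\mathbf{x}\in\mathbb{R}^{n}.$$ Moreover, if $X$ satisfies this condition, then the solution of the equation $X=\nabla^{R}_{b}H$ is given by $H(\mathbf{x})=\int_{0}^{1}b(\mathbf{x},X(t\mathbf{x}))\,\mathrm{d}t+\text{constant}$, $\forall\mathbf{x}\in\mathbb{R}^{n}$. (iii) If $b$ is symmetric, then $X=\nabla_{b}H$ for some $H\in\mathcal{C}^{2}(\mathbb{R}^{n},\mathbb{R})$ if and only if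 $$(\mathrm{D}X(\mathbf{x}))^{\top}B^{-1}=B^{-1}\mathrm{D}X(\mathbf{x}),\quad\forall\mathbf{x}\in\mathbb{R}^{n}.$$ Moreover, if $X$ satisfies this condition, then the solution of the equation $X=\nabla_{b}H$ is given by $H(\mathbf{x})=\int_{0}^{1}b(X(t\mathbf{x}),\mathbf{x})\,\mathrm{d}t+\text{constant}$, $\forall\mathbf{x}\in\mathbb{R}^{n}$. (iv) If $n$ is even and $b$ is skew-symmetric (i.e. $b$ is a symplectic form), then $X=\nabla_{b}H$ for some $H\in\mathcal{C}^{2}(\mathbb{R}^{n},\mathbb{R})$ if and only if $$(\mathrm{D}X(\mathbf{x}))^{\top}B^{-1}+B^{-1}\mathrm{D}X(\mathbf{x})=O_{n},\quad\forall\mathbf{x}\in\mathbb{R}^{n}.$$ Moreover, if $X$ satisfies this condition, then the solution of the equation $X=\nabla_{b}H$ is given by $H(\mathbf{x})=\int_{0}^{1}b(X(t\mathbf{x}),\mathbf{x})\,\mathrm{d}t+\text{constant}$, $\forall\mathbf{x}\in\mathbb{R}^{n}$. Here $\nabla_{b}H$ is precisely the Hamiltonian vector field $X_H$ of $H$ with respect to the symplectic form $b$.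
   Context: A geometric structure on $\mathbb{R}^n$ is a nondegenerate real bilinear form $b$ on $\mathbb{R}^n$. For each such $b$ there is a unique invertible linear map $B$ of $\mathbb{R}^n$ with $\langle\mathbf{x},\mathbf{y}\rangle=b(\mathbf{x},B\mathbf{y})$ for all $\mathbf{x},\mathbf{y}\in\mathbb{R}^n$, where $\langle\cdot,\cdot\rangle$ is the canonical inner product; $(b,B)$ is called the associated geometric pair. $B^{\star}$ is the (left) adjoint of $B$ with respect to $b$, uniquely defined by $b(B^{\star}\mathbf{x},\mathbf{y})=b(\mathbf{x},B\mathbf{y})$ for all $\mathbf{x},\mathbf{y}$. $A^\top$ denotes the adjoint (transpose) of $A$ with respect to $\langle\cdot,\cdot\rangle$, $\mathrm{D}X(\mathbf{x})$ is the Jacobian of $X$ at $\mathbf{x}$, and $O_n$ is the zero $n\times n$ matrix. For $F\in\mathcal{C}^1(\mathbb{R}^n,\mathbb{R})$, the left-gradient $\nabla^L_bF$ and right-gradient $\nabla^R_bF$ are the vector fields uniquely defined by $$b(\nabla^{L}_{b}F(\mathbf{x}),\mathbf{v})=\mathrm{d}F(\mathbf{x})\cdot\mathbf{v},\qquad b(\mathbf{v},\nabla^{R}_{b}F(\mathbf{x}))=\mathrm{d}F(\mathbf{x})\cdot\mathbf{v},\qquad\forall\mathbf{x},\mathbf{v}\in\mathbb{R}^{n}.$$ If $b$ is symmetric then $\nabla^L_b=\nabla^R_b$, and if $b$ is skew-symmetric then $\nabla^L_b=-\nabla^R_b$; in both cases one writes $\nabla_bF:=\nabla^L_bF$. The Hamiltonian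 vector field $X_H$ with respect to a symplectic form $b$ is defined by $b(X_H(\mathbf{x}),\mathbf{v})=\mathrm{d}H(\mathbf{x})\cdot\mathbf{v}$. "The solution is given by [formula] + constant" means that the solutions $H$ of the equation are exactly the functions given by the formula for an arbitrary real constant. *)

theory Defs
  imports "HOL-Analysis.Analysis"
begin

text \<open>
  The space is \<^typ>\<open>real^'n\<close>, with \<open>n = CARD('n)\<close>. Linear maps of it are represented by their
  matrices in the canonical basis.
\<close>

section \<open>Maps of class C1 and C2\<close>

definition C1_map :: "('a::real_normed_vector \<Rightarrow> 'b::real_normed_vector) \<Rightarrow> bool" where
  "C1_map f \<longleftrightarrow> (\<exists>f' :: 'a \<Rightarrow> ('a \<Rightarrow>\<^sub>L 'b).
     (\<forall>x. (f has_derivative blinfun_apply (f' x)) (at x)) \<and> continuous_on UNIV f')"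

definition C2_map :: "('a::real_normed_vector \<Rightarrow> 'b::real_normed_vector) \<Rightarrow> bool" where
  "C2_map f \<longleftrightarrow> (\<exists>f' :: 'a \<Rightarrow> ('a \<Rightarrow>\<^sub>L 'b).
     (\<forall>x. (f has_derivative blinfun_apply (f' x)) (at x)) \<and> C1_map f')"

lemma C2_map_imp_C1_map: "C2_map f \<Longrightarrow> C1_map f"
  unfolding C1_map_def C2_map_def
  by (meson continuous_at_imp_continuous_on has_derivative_continuous)

lemma C1_map_differentiable: "C1_map f \<Longrightarrow> f differentiable (at x)"
  unfolding C1_map_def differentiable_def by blast


section \<open>Geometric structures\<close>

definition nondegenerate :: "('a::real_vector \<Rightarrow> 'a \<Rightarrow> real) \<Rightarrow> bool" where
  "nondegenerate b \<longleftrightarrow>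
     (\<forall>x. (\<forall>y. b x y = 0) \<longrightarrow> x = 0) \<and> (\<forall>y. (\<forall>x. b x y = 0) \<longrightarrow> y = 0)"

definition geometric_structure :: "(real^'n \<Rightarrow> real^'n \<Rightarrow> real) \<Rightarrow> bool" where
  "geometric_structure b \<longleftrightarrow> bilinear b \<and> nondegenerate b"

definition symmetric_form :: "('a \<Rightarrow> 'a \<Rightarrow> real) \<Rightarrow> bool" where
  "symmetric_form b \<longleftrightarrow> (\<forall>x y. b x y = b y x)"

definition skew_symmetric_form :: "('a \<Rightarrow> 'a \<Rightarrow> real) \<Rightarrow> bool" where
  "skew_symmetric_form b \<longleftrightarrow> (\<forall>x y. b x y = - b y x)"

definition geometric_pair :: "(real^'n \<Rightarrow> real^'n \<Rightarrow> real) \<Rightarrow> real^'n^'n \<Rightarrow> bool" where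
  "geometric_pair b B \<longleftrightarrow>
     geometric_structure b \<and> invertible B \<and> (\<forall>x y. x \<bullet> y = b x (B *v y))"

text \<open>Adjoint and gradients are unique by nondegeneracy; existence is shown at the end.\<close>

definition left_adjoint :: "(real^'n \<Rightarrow> real^'n \<Rightarrow> real) \<Rightarrow> real^'n^'n \<Rightarrow> real^'n^'n" where
  "left_adjoint b A = (THE C. \<forall>x y. b (C *v x) y = b x (A *v y))"

definition left_gradient ::
    "(real^'n \<Rightarrow> real^'n \<Rightarrow> real) \<Rightarrow> (real^'n \<Rightarrow> real) \<Rightarrow> real^'n \<Rightarrow> real^'n" where
  "left_gradient b F x = (THE w. \<forall>v. b w v = frechet_derivative F (at x) v)"

definition right_gradient ::
    "(real^'n \<Rightarrow> real^'n \<Rightarrow> real) \<Rightarrow> (real^'n \<Rightarrow> real) \<Rightarrow> real^'n \<Rightarrow> real^'n" where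
  "right_gradient b F x = (THE w. \<forall>v. b v w = frechet_derivative F (at x) v)"

text \<open>Meant only for forms that are symmetric or skew-symmetric.\<close>

definition gradient ::
    "(real^'n \<Rightarrow> real^'n \<Rightarrow> real) \<Rightarrow> (real^'n \<Rightarrow> real) \<Rightarrow> real^'n \<Rightarrow> real^'n" where
  "gradient b F = left_gradient b F"

text \<open>Meant only for symplectic, that is nondegenerate skew-symmetric, forms.\<close>

definition hamiltonian_vector_field ::
    "(real^'n \<Rightarrow> real^'n \<Rightarrow> real) \<Rightarrow> (real^'n \<Rightarrow> real) \<Rightarrow> real^'n \<Rightarrow> real^'n" where
  "hamiltonian_vector_field b H x = (THE w. \<forall>v. b w v = frechet_derivative H (at x) v)"


section \<open>Well-definedness\<close>

lemma geometric_structure_matrix: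
  assumes "geometric_structure b"
  obtains M where "invertible M" "\<And>x y. b x y = x \<bullet> (M *v y)"
proof -
  have bl: "bilinear b" and nd: "nondegenerate b"
    using assms by (auto simp: geometric_structure_def)
  define g where "g y = adjoint (\<lambda>x. b x y) 1" for y
  have g: "b x y = x \<bullet> g y" for x y
    using adjoint_works[of "\<lambda>x. b x y" x 1] bl by (simp add: g_def bilinear_def)
  have "linear g"
  proof (rule linearI)
    show "g (y + z) = g y + g z" for y z
      by (rule vector_eq_rdot[THEN iffD1])
        (metis bilinear_radd[OF bl] g inner_add_right inner_commute)
    show "g (c *\<^sub>R y) = c *\<^sub>R g y" for c y
      by (rule vector_eq_rdot[THEN iffD1])
        (metis bilinear_rmul[OF bl] g inner_scaleR_right inner_commute real_scaleR_def)
  qed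
  then have M: "matrix g *v y = g y" for y
    by (simp add: matrix_works)
  have "y = 0" if "matrix g *v y = 0" for y
    using nd that by (auto simp: nondegenerate_def g M)
  then have "invertible (matrix g)"
    by (metis invertible_left_inverse matrix_left_invertible_ker)
  then show thesis
    by (rule that) (simp add: g M)
qed

lemma matrix_inv_works:
  assumes "invertible (A::real^'n^'n)"
  shows "A ** matrix_inv A = mat 1" "matrix_inv A ** A = mat 1"
  using someI_ex[OF assms[unfolded invertible_def]] unfolding matrix_inv_def by auto

lemma geometric_pair_ex1:
  assumes "geometric_structure b"
  shows "\<exists>!B. geometric_pair b B"
proof -
  obtain M where M: "invertible M" "\<And>x y. b x y = x \<bullet> (M *v y)"
    using geometric_structure_matrix[OF assms] by blast
  have eq: "(\<forall>x y. x \<bullet> y = b x (B *v y)) \<longleftrightarrow> M ** B = mat 1" for B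
  proof
    assume "\<forall>x y. x \<bullet> y = b x (B *v y)"
    then have "\<forall>x. x \<bullet> ((M ** B) *v y) = x \<bullet> (mat 1 *v y)" for y
      by (simp add: M(2) matrix_vector_mul_assoc)
    then have "(M ** B) *v y = mat 1 *v y" for y
      by (simp only: vector_eq_ldot)
    then show "M ** B = mat 1"
      by (simp add: matrix_eq)
  qed (simp add: M(2) matrix_vector_mul_assoc)
  show ?thesis
  proof (rule ex1I[of _ "matrix_inv M"])
    show "geometric_pair b (matrix_inv M)"
      unfolding geometric_pair_def eq
      using assms matrix_inv_works[OF M(1)] by (auto simp: invertible_def)
    fix B assume "geometric_pair b B"
    then have "matrix_inv M ** (M ** B) = matrix_inv M"
      by (simp add: geometric_pair_def eq)
    then show "B = matrix_inv M"
      by (simp add: matrix_mul_assoc matrix_inv_works[OF M(1)])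
  qed
qed

lemma left_riesz_ex1:
  assumes "geometric_structure b" "linear f"
  shows "\<exists>!w. \<forall>v. b w v = f v"
proof -
  obtain M where M: "invertible M" "\<And>x y. b x y = x \<bullet> (M *v y)"
    using geometric_structure_matrix[OF assms(1)] by blast
  define u where "u = adjoint f 1"
  define N where "N = transpose M"
  have f: "f v = u \<bullet> v" for v
    using adjoint_works[OF assms(2), of v 1] by (simp add: u_def inner_commute)
  have b: "b w v = (N *v w) \<bullet> v" for w v
    by (simp add: M(2) N_def dot_lmul_matrix)
  have eq: "(\<forall>v. b w v = f v) \<longleftrightarrow> N *v w = u" for w
    unfolding b f by (rule vector_eq_rdot)
  have N: "invertible N"
    using M(1) by (simp add: N_def transpose_invertible)
  show ?thesis
    unfolding eq
  proof (rule ex1I[of _ "matrix_inv N *v u"])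
    show "N *v (matrix_inv N *v u) = u"
      by (simp add: matrix_vector_mul_assoc matrix_inv_works[OF N])
    show "w = matrix_inv N *v u" if "N *v w = u" for w
      using that by (auto simp: matrix_vector_mul_assoc matrix_inv_works[OF N])
  qed
qed

lemma right_riesz_ex1:
  assumes "geometric_structure b" "linear f"
  shows "\<exists>!w. \<forall>v. b v w = f v"
proof -
  have "geometric_structure (\<lambda>x y. b y x)"
    using assms(1) unfolding geometric_structure_def bilinear_def nondegenerate_def by blast
  from left_riesz_ex1[OF this assms(2)] show ?thesis .
qed

lemma left_gradient_works:
  assumes "geometric_structure b" "C1_map F"
  shows "b (left_gradient b F x) v = frechet_derivative F (at x) v"
  using theI'[OF left_riesz_ex1[OF assms(1)
      linear_frechet_derivative[OF C1_map_differentiable[OF assms(2), of x]]]]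
  unfolding left_gradient_def by blast

lemma right_gradient_works:
  assumes "geometric_structure b" "C1_map F"
  shows "b v (right_gradient b F x) = frechet_derivative F (at x) v"
  using theI'[OF right_riesz_ex1[OF assms(1)
      linear_frechet_derivative[OF C1_map_differentiable[OF assms(2), of x]]]]
  unfolding right_gradient_def by blast

lemma left_adjoint_works:
  fixes b :: "real^'n \<Rightarrow> real^'n \<Rightarrow> real"
  assumes "geometric_structure b"
  shows "b (left_adjoint b A *v x) y = b x (A *v y)"
proof -
  obtain M where M: "invertible M" "\<And>x y. b x y = x \<bullet> (M *v y)"
    using geometric_structure_matrix[OF assms] by blast
  have t: "b (C *v x) y = x \<bullet> ((transpose C ** M) *v y)" for C :: "real^'n^'n" and x y
    using dot_lmul_matrix[of x "transpose C" "M *v y"]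
    by (simp add: M(2) matrix_vector_mul_assoc)
  have eq: "(\<forall>x y. b (C *v x) y = b x (A *v y)) \<longleftrightarrow> transpose C ** M = M ** A" for C
  proof
    assume "\<forall>x y. b (C *v x) y = b x (A *v y)"
    then have "\<forall>x. x \<bullet> ((transpose C ** M) *v y) = x \<bullet> ((M ** A) *v y)" for y
      unfolding t by (simp only: M(2) matrix_vector_mul_assoc) blast
    then have "(transpose C ** M) *v y = (M ** A) *v y" for y
      by (simp only: vector_eq_ldot)
    then show "transpose C ** M = M ** A"
      by (simp add: matrix_eq)
  qed (simp only: t, simp add: M(2) matrix_vector_mul_assoc)
  have "\<exists>!C. transpose C ** M = M ** A"
  proof (rule ex1I[of _ "transpose (M ** A ** matrix_inv M)"])
    show "transpose (transpose (M ** A ** matrix_inv M)) ** M = M ** A"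
      by (simp add: matrix_inv_works[OF M(1)] flip: matrix_mul_assoc)
    fix C assume "transpose C ** M = M ** A"
    then have "transpose C ** M ** matrix_inv M = M ** A ** matrix_inv M"
      by simp
    then have "transpose C = M ** A ** matrix_inv M"
      by (simp add: matrix_inv_works[OF M(1)] flip: matrix_mul_assoc)
    then show "C = transpose (M ** A ** matrix_inv M)"
      by (metis transpose_transpose)
  qed
  then have "\<exists>!C. \<forall>x y. b (C *v x) y = b x (A *v y)"
    by (simp only: eq)
  from theI'[OF this] show ?thesis
    unfolding left_adjoint_def by blast
qed

lemma gradients_symmetric: "symmetric_form b \<Longrightarrow> left_gradient b F = right_gradient b F"
proof -
  assume "symmetric_form b"
  then have "b w v = b v w" for v w
    by (simp add: symmetric_form_def)
  then show ?thesis
    by (simp add: left_gradient_def right_gradient_def fun_eq_iff)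
qed

lemma gradients_skew_symmetric:
  assumes "geometric_structure b" "skew_symmetric_form b" "C1_map F"
  shows "left_gradient b F x = - right_gradient b F x"
proof -
  have bl: "bilinear b"
    using assms(1) by (simp add: geometric_structure_def)
  have skew: "b w v = - b v w" for w v
    using assms(2) unfolding skew_symmetric_form_def by blast
  have "b (- right_gradient b F x) v = frechet_derivative F (at x) v" for v
    unfolding bilinear_lneg[OF bl] skew[of "right_gradient b F x" v]
    by (simp add: right_gradient_works[OF assms(1,3)])
  moreover have "\<exists>!w. \<forall>v. b w v = frechet_derivative F (at x) v"
    by (intro left_riesz_ex1 assms linear_frechet_derivative C1_map_differentiable)
  ultimately show ?thesis
    using left_gradient_works[OF assms(1,3)] by metis
qed

end

theory Submission
  imports Defs
begin

text \<open>
  A pair $(b, B)$ satisfies $b(x, y) = x \cdot B^{-1} y$ and $(B^{\star})^{-1} = (B^{-1})^{\top}$. So $X$ is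
  a left gradient of $H$ iff the vector field $Y = (B^{-1})^{\top} X$ is the Euclidean gradient of $H$, a
  right gradient iff $Y = B^{-1} X$ is, and each matrix condition says that the derivative of $Y$
  is symmetric. What remains is the Poincare lemma for $Y$: a derivative of a gradient is
  symmetric by comparing second differences, and conversely the radial integral is a potential by
  differentiation under the integral sign.
\<close>

section \<open>Symmetry of the derivative of a gradient field\<close>

text \<open>The second difference of \<open>H\<close> along \<open>u\<close> and \<open>v\<close>
  does not change when \<open>u\<close> and \<open>v\<close> are swapped, while to order
  \<open>s\<^sup>2\<close> it equals both \<open>s\<^sup>2 * (A v \<bullet> u)\<close> and
  \<open>s\<^sup>2 * (A u \<bullet> v)\<close>. Only the linearization of \<open>Y\<close> at the
  one point \<open>x\<close> enters.\<close>

lemma gradient_derivative_symmetric: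
  fixes H :: "'a::real_inner \<Rightarrow> real"
  assumes H: "\<And>x. (H has_derivative (\<lambda>v. Y x \<bullet> v)) (at x)"
    and Y: "(Y has_derivative A) (at x)"
  shows "A u \<bullet> v = A v \<bullet> u"
proof -
  define K where "K u v = norm u + norm v" for u v :: 'a
  define \<Delta> where
    "\<Delta> s u v = H (x + s *\<^sub>R u + s *\<^sub>R v) - H (x + s *\<^sub>R u) - H (x + s *\<^sub>R v) + H x" for s u v
  have bl: "bounded_linear A"
    using Y by (rule has_derivative_bounded_linear)
  have estimate: "\<bar>\<Delta> s u v - s\<^sup>2 * (A v \<bullet> u)\<bar> \<le> 2 * e * s\<^sup>2 * (K u v)\<^sup>2"
    if "s > 0" "e > 0" "s * K u v < d"
      and d: "\<And>h. norm h < d \<Longrightarrow> norm (Y (x + h) - Y x - A h) \<le> e * norm h"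
    for s e d u v
  proof -
    \<comment> \<open>Mean value theorem in the direction \<open>u\<close> alone, for \<open>H (x +
      r *\<^sub>R u + s *\<^sub>R v) - H (x + r *\<^sub>R u)\<close> as a function of
      \<open>r\<close> on \<open>[0, s]\<close>. It turns the second difference into a first
      difference of \<open>Y\<close>.\<close>
    have "\<exists>\<xi>\<in>{0<..<s}. (H (x + s *\<^sub>R u + s *\<^sub>R v) - H (x + s *\<^sub>R u)) -
        (H (x + 0 *\<^sub>R u + s *\<^sub>R v) - H (x + 0 *\<^sub>R u)) =
        Y (x + \<xi> *\<^sub>R u + s *\<^sub>R v) \<bullet> ((s - 0) *\<^sub>R u) - Y (x + \<xi> *\<^sub>R u) \<bullet> ((s - 0) *\<^sub>R u)"
      by (rule mvt_simple[OF \<open>s > 0\<close>])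
        (auto intro!: derivative_eq_intros has_derivative_compose[OF _ H])
    then obtain \<xi> where \<xi>: "0 < \<xi>" "\<xi> < s"
      and eq: "\<Delta> s u v = s * ((Y (x + \<xi> *\<^sub>R u + s *\<^sub>R v) - Y (x + \<xi> *\<^sub>R u)) \<bullet> u)"
      by (auto simp: \<Delta>_def algebra_simps inner_diff_left)
    define p where "p = \<xi> *\<^sub>R u + s *\<^sub>R v"
    define q where "q = \<xi> *\<^sub>R u"
    have q: "norm q \<le> s * K u v" and p: "norm p \<le> s * K u v"
    proof -
      have *: "\<xi> * norm u \<le> s * norm u"
        using \<xi> by (intro mult_right_mono) auto
      have **: "0 \<le> s * norm v"
        using \<open>s > 0\<close> by simp
      show "norm p \<le> s * K u v"
        using norm_triangle_ineq[of "\<xi> *\<^sub>R u" "s *\<^sub>R v"] \<xi> * \<open>s > 0\<close>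
        by (simp add: p_def K_def distrib_left)
      show "norm q \<le> s * K u v"
        using \<xi> add_mono[OF * **] by (simp add: q_def K_def distrib_left)
    qed
    \<comment> \<open>Both values of \<open>Y\<close> are compared with its linearization at
      \<open>x\<close>. Since \<open>p - q = s *\<^sub>R v\<close>, the linear parts differ by
      exactly \<open>s *\<^sub>R A v\<close>.\<close>
    have "norm (Y (x + p) - Y (x + q) - s *\<^sub>R A v) =
        norm ((Y (x + p) - Y x - A p) - (Y (x + q) - Y x - A q))"
      by (simp add: p_def q_def linear_add[OF bounded_linear.linear[OF bl]]
          linear_scale[OF bounded_linear.linear[OF bl]] algebra_simps)
    also have "\<dots> \<le> norm (Y (x + p) - Y x - A p) + norm (Y (x + q) - Y x - A q)"
      by (rule norm_triangle_ineq4)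
    also have "\<dots> \<le> e * norm p + e * norm q"
      using p q \<open>s * K u v < d\<close> by (intro add_mono d) auto
    also have "\<dots> \<le> e * (s * K u v) + e * (s * K u v)"
      using p q \<open>e > 0\<close> by (intro add_mono mult_left_mono) auto
    finally have dist: "norm (Y (x + p) - Y (x + q) - s *\<^sub>R A v) \<le> 2 * e * s * K u v"
      by (simp add: algebra_simps)
    have K: "norm u \<le> K u v" "0 \<le> K u v"
      by (simp_all add: K_def)
    have "\<Delta> s u v - s\<^sup>2 * (A v \<bullet> u) = s * ((Y (x + p) - Y (x + q) - s *\<^sub>R A v) \<bullet> u)"
      by (simp add: eq p_def q_def algebra_simps power2_eq_square inner_diff_left)
    also have "\<bar>\<dots>\<bar> \<le> s * (norm (Y (x + p) - Y (x + q) - s *\<^sub>R A v) * norm u)"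
      using \<open>s > 0\<close> by (simp add: abs_mult Cauchy_Schwarz_ineq2)
    also have "\<dots> \<le> s * ((2 * e * s * K u v) * K u v)"
      using dist K \<open>s > 0\<close> \<open>e > 0\<close> by (intro mult_left_mono mult_mono) auto
    finally show ?thesis
      by (simp add: power2_eq_square algebra_simps)
  qed
  have small: "\<bar>A u \<bullet> v - A v \<bullet> u\<bar> \<le> e * (4 * (K u v)\<^sup>2)" if e: "e > 0" for e
  proof -
    obtain d where "d > 0" and d: "\<And>h. norm h < d \<Longrightarrow> norm (Y (x + h) - Y x - A h) \<le> e * norm h"
      using Y e unfolding has_derivative_at_alt by (metis add_diff_cancel_left')
    \<comment> \<open>Any positive \<open>s\<close> with \<open>s * K u v < d\<close> would do; the
      added 1 keeps the denominator positive when \<open>u\<close> and \<open>v\<close> are both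
      zero.\<close>
    define s where "s = d / (2 * (K u v + 1))"
    have K: "K u v \<ge> 0"
      by (simp add: K_def)
    then have s: "s > 0"
      using \<open>d > 0\<close> by (simp add: s_def)
    have "d * K u v < d * (2 * (K u v + 1))"
      using \<open>d > 0\<close> K by (intro mult_strict_left_mono) auto
    then have sK: "s * K u v < d"
      using K by (simp add: s_def divide_simps)
    have sym: "\<Delta> s v u = \<Delta> s u v" "K v u = K u v"
      by (simp_all add: \<Delta>_def K_def algebra_simps)
    have "s\<^sup>2 * \<bar>A u \<bullet> v - A v \<bullet> u\<bar> = \<bar>s\<^sup>2 * (A u \<bullet> v) - s\<^sup>2 * (A v \<bullet> u)\<bar>"
      by (simp add: abs_mult flip: right_diff_distrib)
    \<comment> \<open>The estimate is applied to \<open>u, v\<close> and to \<open>v, u\<close>;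
      both compare with the same second difference, so the two errors add.\<close>
    also have "\<dots> \<le> 4 * e * s\<^sup>2 * (K u v)\<^sup>2"
      using estimate[of s e u v d, OF s e sK d] estimate[of s e v u d, OF s e _ d] sK
      unfolding sym by linarith
    finally have "s\<^sup>2 * \<bar>A u \<bullet> v - A v \<bullet> u\<bar> \<le> s\<^sup>2 * (e * (4 * (K u v)\<^sup>2))"
      by (simp add: mult_ac)
    then show ?thesis
      using s by simp
  qed
  show ?thesis
  proof (rule ccontr)
    assume "A u \<bullet> v \<noteq> A v \<bullet> u"
    then have pos: "\<bar>A u \<bullet> v - A v \<bullet> u\<bar> > 0"
      by simp
    \<comment> \<open>Chosen so that the bound in \<open>small\<close> falls strictly below the
      quantity it is supposed to bound.\<close>
    define e where "e = \<bar>A u \<bullet> v - A v \<bullet> u\<bar> / (4 * (K u v)\<^sup>2 + 1)"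
    have den: "4 * (K u v)\<^sup>2 + 1 > 0"
      by (simp add: add_nonneg_pos)
    then have "e > 0"
      using pos by (simp add: e_def)
    have "e * (4 * (K u v)\<^sup>2) < e * (4 * (K u v)\<^sup>2 + 1)"
      using \<open>e > 0\<close> by simp
    also have "\<dots> = \<bar>A u \<bullet> v - A v \<bullet> u\<bar>"
      using den by (simp add: e_def)
    finally show False
      using small[OF \<open>e > 0\<close>] by simp
  qed
qed

section \<open>The radial integral as a potential\<close>

text \<open>Differentiating the integrand in the direction \<open>v\<close> gives \<open>Y (t
  *\<^sub>R x) \<bullet> v + t * (Y' (t *\<^sub>R x) v \<bullet> x)\<close>. By symmetry this is the
  \<open>t\<close>-derivative of \<open>t * (Y (t *\<^sub>R x) \<bullet> v)\<close>, which increases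
  from 0 to \<open>Y x \<bullet> v\<close> in the sense of net change over
  \<open>[0, 1]\<close>.\<close>

lemma radial_integral_has_gradient:
  fixes Y :: "'a::euclidean_space \<Rightarrow> 'a" and Y' :: "'a \<Rightarrow> 'a \<Rightarrow>\<^sub>L 'a"
  assumes Y: "\<And>x. (Y has_derivative blinfun_apply (Y' x)) (at x)"
    and cont: "continuous_on UNIV Y'"
    and sym: "\<And>x u v. Y' x u \<bullet> v = Y' x v \<bullet> u"
  shows "((\<lambda>x. integral {0..1} (\<lambda>t. Y (t *\<^sub>R x) \<bullet> x)) has_derivative (\<lambda>v. Y x \<bullet> v)) (at x)"
proof -
  have contY: "continuous_on S Y" for S
    by (meson Y has_derivative_continuous continuous_at_imp_continuous_on)
  have contY_comp: "continuous_on S (\<lambda>z. Y (g z))" if "continuous_on S g"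
    for S and g :: "'b::topological_space \<Rightarrow> 'a"
    using continuous_on_compose2[OF contY[of UNIV] that] by simp
  have contY'_comp: "continuous_on S (\<lambda>z. Y' (g z))" if "continuous_on S g"
    for S and g :: "'b::topological_space \<Rightarrow> 'a"
    using continuous_on_compose2[OF cont that] by simp
  \<comment> \<open>The derivative of the integrand in \<open>x\<close>, packed as a bounded linear
    function because \<open>leibniz_rule\<close> integrates derivatives in that space.\<close>
  define D :: "'a \<Rightarrow> real \<Rightarrow> 'a \<Rightarrow>\<^sub>L real" where
    "D x t = blinfun_inner_right (Y (t *\<^sub>R x)) + t *\<^sub>R (blinfun_inner_right x o\<^sub>L Y' (t *\<^sub>R x))" for x t
  have D: "D x t v = Y (t *\<^sub>R x) \<bullet> v + t * (Y' (t *\<^sub>R x) v \<bullet> x)" for x t v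
    by (simp add: D_def blinfun.bilinear_simps inner_commute)
  have "((\<lambda>x. integral (cbox 0 1) (\<lambda>t. Y (t *\<^sub>R x) \<bullet> x)) has_derivative
      integral (cbox 0 1) (D x)) (at x within UNIV)"
  proof (rule leibniz_rule)
    show "((\<lambda>x. Y (t *\<^sub>R x) \<bullet> x) has_derivative blinfun_apply (D x t)) (at x within UNIV)" for x t
      by (auto intro!: derivative_eq_intros has_derivative_compose[OF _ Y]
          simp: D fun_eq_iff blinfun.bilinear_simps)
    show "(\<lambda>t. Y (t *\<^sub>R x) \<bullet> x) integrable_on cbox 0 1" for x
      by (intro integrable_continuous continuous_intros contY_comp)
    show "continuous_on (UNIV \<times> cbox 0 1) (\<lambda>(x, t). D x t)"
      unfolding D_def case_prod_unfold
      by (intro continuous_intros contY_comp contY'_comp)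
  qed auto
  moreover have "blinfun_apply (integral (cbox 0 1) (D x)) = (\<lambda>v. Y x \<bullet> v)"
  proof
    fix v
    have "(D x) integrable_on cbox 0 1"
      unfolding D_def by (intro integrable_continuous continuous_intros contY_comp contY'_comp)
    \<comment> \<open>Evaluation at \<open>v\<close> is bounded linear, so it commutes with the
      integral.\<close>
    then have "integral (cbox 0 1) (D x) v = integral {0..1} (\<lambda>t. D x t v)"
      using integral_linear[OF _ blinfun.bounded_linear_left, of "D x" "cbox 0 1" v]
      by (simp add: o_def)
    \<comment> \<open>The only use of \<open>sym\<close>: it exchanges \<open>v\<close> and
      \<open>x\<close>, which makes the integrand an exact derivative in \<open>t\<close>.\<close>
    moreover have "((\<lambda>t. D x t v) has_integral (1 *\<^sub>R Y (1 *\<^sub>R x) \<bullet> v - 0 *\<^sub>R Y (0 *\<^sub>R x) \<bullet> v)) {0..1}"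
    proof (rule fundamental_theorem_of_calculus)
      fix t :: real
      show "((\<lambda>t. t *\<^sub>R Y (t *\<^sub>R x) \<bullet> v) has_vector_derivative D x t v) (at t within {0..1})"
        unfolding has_vector_derivative_def D sym[of _ v x]
        by (auto intro!: derivative_eq_intros has_derivative_compose[OF _ Y]
          simp: fun_eq_iff blinfun.bilinear_simps algebra_simps)
    qed simp
    ultimately show "integral (cbox 0 1) (D x) v = Y x \<bullet> v"
      by (simp add: integral_unique)
  qed
  ultimately show ?thesis
    by simp
qed

section \<open>Regularity of potentials and the symmetric Jacobian criterion\<close>

lemma C1_map_bounded_linear_compose:
  assumes "bounded_linear f" "C1_map g"
  shows "C1_map (\<lambda>x. f (g x))"
proof -
  obtain g' where g': "\<And>x. (g has_derivative blinfun_apply (g' x)) (at x)" "continuous_on UNIV g'"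
    using assms(2) unfolding C1_map_def by blast
  have "((\<lambda>x. f (g x)) has_derivative blinfun_apply (Blinfun f o\<^sub>L g' x)) (at x)" for x
    using bounded_linear.has_derivative[OF assms(1) g'(1)[of x]]
    by (simp add: bounded_linear_Blinfun_apply[OF assms(1)] blinfun_compose.rep_eq o_def)
  moreover have "continuous_on UNIV (\<lambda>x. Blinfun f o\<^sub>L g' x)"
    by (intro continuous_intros g')
  ultimately show ?thesis
    unfolding C1_map_def by (intro exI[of _ "\<lambda>x. Blinfun f o\<^sub>L g' x"]) blast
qed

text \<open>The derivative of \<open>H\<close> is \<open>Y\<close> followed by the bounded linear
  map \<open>blinfun_inner_right\<close>, hence as smooth as \<open>Y\<close>.\<close>

lemma C2_map_gradientI:
  assumes "\<And>x. (H has_derivative (\<lambda>v. Y x \<bullet> v)) (at x)" "C1_map Y"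
  shows "C2_map H"
  unfolding C2_map_def
  using assms C1_map_bounded_linear_compose[OF bounded_linear_blinfun_inner_right assms(2)]
  by (intro exI[of _ "\<lambda>x. blinfun_inner_right (Y x)"]) auto

text \<open>The matrix \<open>N\<close> is left free so that one statement serves left gradients,
  with \<open>N\<close> the transpose of the inverse of \<open>B\<close>, and right gradients, with
  \<open>N\<close> that inverse. The last conclusion lets class C2 be dropped from and restored to
  the description of potentials.\<close>

lemma gradient_iff_jacobian_symmetric:
  fixes X :: "real^'n \<Rightarrow> real^'n" and N :: "real^'n^'n"
  assumes X: "C1_map X"
  defines "symmetric_jacobian \<equiv>
      \<forall>x. transpose (jacobian X (at x)) ** transpose N = N ** jacobian X (at x)"
    and "potential \<equiv> \<lambda>H. \<forall>x. (H has_derivative (\<lambda>v. (N *v X x) \<bullet> v)) (at x)"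
  shows "(\<exists>H. potential H) \<longleftrightarrow> symmetric_jacobian"
    and "symmetric_jacobian \<Longrightarrow>
      potential H \<longleftrightarrow> (\<exists>c. \<forall>x. H x = integral {0..1} (\<lambda>t. (N *v X (t *\<^sub>R x)) \<bullet> x) + c)"
    and "potential H \<Longrightarrow> C2_map H"
proof -
  define Y where "Y x = N *v X x" for x
  have C1: "C1_map Y"
    unfolding Y_def by (intro C1_map_bounded_linear_compose[OF matrix_vector_mul_bounded_linear] X)
  have der: "(Y has_derivative (\<lambda>h. (N ** jacobian X (at x)) *v h)) (at x)" for x
    using bounded_linear.has_derivative[OF matrix_vector_mul_bounded_linear
        jacobian_works[THEN iffD1, OF C1_map_differentiable[OF X]]]
    by (simp add: Y_def[abs_def] matrix_vector_mul_assoc)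
  \<comment> \<open>The left side of the matrix condition is the transpose of its right side, so the
    condition says that the Jacobian matrix of \<open>Y\<close> is symmetric.\<close>
  have sym_iff: "transpose (jacobian X (at x)) ** transpose N = N ** jacobian X (at x) \<longleftrightarrow>
      (\<forall>u v. ((N ** jacobian X (at x)) *v u) \<bullet> v = ((N ** jacobian X (at x)) *v v) \<bullet> u)"
    (is "_ \<longleftrightarrow> ?S") for x
  proof -
    let ?A = "N ** jacobian X (at x)"
    have t: "(?A *v v) \<bullet> u = (transpose ?A *v u) \<bullet> v" for u v
      using dot_lmul_matrix[of u ?A v] by (simp add: inner_commute)
    have "?S \<longleftrightarrow> (\<forall>u v. (?A *v u) \<bullet> v = (transpose ?A *v u) \<bullet> v)"
      using t by metis
    also have "\<dots> \<longleftrightarrow> (\<forall>u. ?A *v u = transpose ?A *v u)"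
      by (simp only: vector_eq_rdot)
    also have "\<dots> \<longleftrightarrow> ?A = transpose ?A"
      by (simp add: matrix_eq)
    also have "\<dots> \<longleftrightarrow> transpose (jacobian X (at x)) ** transpose N = ?A"
      by (auto simp: matrix_transpose_mul)
    finally show ?thesis ..
  qed
  have pot: "potential H \<longleftrightarrow> (\<forall>x. (H has_derivative (\<lambda>v. Y x \<bullet> v)) (at x))" for H
    by (simp add: potential_def Y_def)
  show "potential H \<Longrightarrow> C2_map H"
    unfolding pot by (rule C2_map_gradientI[OF _ C1]) blast
  have radial: "potential (\<lambda>x. integral {0..1} (\<lambda>t. Y (t *\<^sub>R x) \<bullet> x))" if "symmetric_jacobian"
  proof -
    obtain Y' where Y': "\<And>x. (Y has_derivative blinfun_apply (Y' x)) (at x)" "continuous_on UNIV Y'"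
      using C1 unfolding C1_map_def by blast
    \<comment> \<open>Uniqueness of derivatives carries the symmetry of the matrix over to the
      continuous derivative \<open>Y'\<close>.\<close>
    have "blinfun_apply (Y' x) = (\<lambda>h. (N ** jacobian X (at x)) *v h)" for x
      by (rule has_derivative_unique[OF Y'(1) der])
    then have "Y' x u \<bullet> v = Y' x v \<bullet> u" for x u v
      using that sym_iff unfolding symmetric_jacobian_def by simp
    then show ?thesis
      unfolding pot using radial_integral_has_gradient[OF Y'] by blast
  qed
  have "symmetric_jacobian" if "potential H" for H
    unfolding symmetric_jacobian_def sym_iff
    using gradient_derivative_symmetric[OF _ der] that unfolding pot by blast
  then show "(\<exists>H. potential H) \<longleftrightarrow> symmetric_jacobian"
    using radial by blast
  show "potential H \<longleftrightarrow> (\<exists>c. \<forall>x. H x = integral {0..1} (\<lambda>t. (N *v X (t *\<^sub>R x)) \<bullet> x) + c)"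
    if s: "symmetric_jacobian"
  proof
    define K where "K x = integral {0..1} (\<lambda>t. Y (t *\<^sub>R x) \<bullet> x)" for x
    have K: "(K has_derivative (\<lambda>v. Y x \<bullet> v)) (at x)" for x
      using radial[OF s] unfolding pot K_def by blast
    show "\<exists>c. \<forall>x. H x = integral {0..1} (\<lambda>t. (N *v X (t *\<^sub>R x)) \<bullet> x) + c" if "potential H"
    proof -
      have "((\<lambda>x. H x - K x) has_derivative (\<lambda>h. 0)) (at x within UNIV)" for x
        using has_derivative_diff[OF _ K, of H "\<lambda>v. Y x \<bullet> v" x] that
        unfolding pot by simp
      from has_derivative_zero_constant[OF convex_UNIV this]
      obtain c where "\<And>x. H x - K x = c"
        by auto
      then show ?thesis
        unfolding K_def Y_def by (metis diff_add_cancel add.commute)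
    qed
    assume "\<exists>c. \<forall>x. H x = integral {0..1} (\<lambda>t. (N *v X (t *\<^sub>R x)) \<bullet> x) + c"
    then obtain c where "H = (\<lambda>x. K x + c)"
      unfolding K_def Y_def by blast
    then show "potential H"
      unfolding pot using has_derivative_add_const[OF K] by blast
  qed
qed

section \<open>Matrix form of geometric pairs, and gradients as derivatives\<close>

lemma geometric_pair_matrix_inv:
  assumes "geometric_pair b B"
  shows "b x y = x \<bullet> (matrix_inv B *v y)" "b x y = (transpose (matrix_inv B) *v x) \<bullet> y"
    and "matrix_inv (left_adjoint b B) = transpose (matrix_inv B)"
proof -
  have g: "geometric_structure b" and inv: "invertible B" and b: "\<And>x y. x \<bullet> y = b x (B *v y)"
    using assms by (auto simp: geometric_pair_def)
  note B = matrix_inv_works[OF inv]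
  have 1: "b x y = x \<bullet> (matrix_inv B *v y)" for x y
    unfolding b by (simp add: matrix_vector_mul_assoc B)
  show "b x y = x \<bullet> (matrix_inv B *v y)"
    by (rule 1)
  have 2: "b x y = (transpose (matrix_inv B) *v x) \<bullet> y" for x y
    unfolding 1 by (simp add: dot_lmul_matrix)
  show "b x y = (transpose (matrix_inv B) *v x) \<bullet> y"
    by (rule 2)
  \<comment> \<open>Both sides equal \<open>b (left_adjoint b B *v x) y\<close>: the left one by 2,
    the right one because the adjoint moves \<open>B\<close> onto \<open>y\<close>.\<close>
  have "((transpose (matrix_inv B) ** left_adjoint b B) *v x) \<bullet> y = x \<bullet> y" for x y
    using left_adjoint_works[OF g, of B x y] 2[of "left_adjoint b B *v x" y] b[of x y]
    by (simp add: matrix_vector_mul_assoc)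
  then have L: "transpose (matrix_inv B) ** left_adjoint b B = mat 1"
    by (metis matrix_eq matrix_vector_mul_lid vector_eq_rdot)
  then have "invertible (left_adjoint b B)"
    using invertible_left_inverse by blast
  then have "transpose (matrix_inv B) ** (left_adjoint b B ** matrix_inv (left_adjoint b B))
      = transpose (matrix_inv B)"
    by (simp add: matrix_inv_works)
  then show "matrix_inv (left_adjoint b B) = transpose (matrix_inv B)"
    by (simp add: matrix_mul_assoc L)
qed

text \<open>Replaces the definite description by a derivative statement, the form in which
  potentials are handled. Class C1 makes \<open>frechet_derivative\<close> the true derivative, and
  nondegeneracy makes the described vector unique.\<close>

lemma left_gradient_eq_iff:
  assumes g: "geometric_structure b" and H: "C1_map H"
  shows "X = left_gradient b H \<longleftrightarrow> (\<forall>x. (H has_derivative b (X x)) (at x))"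
proof
  have fd: "(H has_derivative frechet_derivative H (at x)) (at x)" for x
    using C1_map_differentiable[OF H] by (rule frechet_derivative_works[THEN iffD1])
  show "\<forall>x. (H has_derivative b (X x)) (at x)" if "X = left_gradient b H"
  proof
    fix x
    have "b (X x) = frechet_derivative H (at x)"
      using left_gradient_works[OF g H] that by auto
    then show "(H has_derivative b (X x)) (at x)"
      using fd by simp
  qed
  show "X = left_gradient b H" if "\<forall>x. (H has_derivative b (X x)) (at x)"
  proof
    fix x
    have "b (X x) = frechet_derivative H (at x)"
      using that fd has_derivative_unique by blast
    moreover have "\<exists>!w. \<forall>v. b w v = frechet_derivative H (at x) v"
      by (intro left_riesz_ex1 g linear_frechet_derivative C1_map_differentiable H)
    ultimately show "X x = left_gradient b H x"
      using left_gradient_works[OF g H] by metis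
  qed
qed

lemma geometric_structure_flip:
  "geometric_structure b \<Longrightarrow> geometric_structure (\<lambda>x y. b y x)"
  unfolding geometric_structure_def bilinear_def nondegenerate_def by blast

text \<open>Reduces right gradients to left gradients of the form with its arguments
  exchanged.\<close>

lemma right_gradient_eq_left_gradient_flip: "right_gradient b = left_gradient (\<lambda>x y. b y x)"
  by (intro ext) (simp add: right_gradient_def left_gradient_def)

section \<open>The left, right, symmetric and symplectic cases\<close>

theorem theorem2p7:
  fixes X :: "real^'n \<Rightarrow> real^'n"
    and b :: "real^'n \<Rightarrow> real^'n \<Rightarrow> real"
    and B :: "real^'n^'n"
  assumes "C1_map X"
    and "geometric_structure b"
    and "geometric_pair b B"
  shows
    "(((\<exists>H. C2_map H \<and> X = left_gradient b H) \<longleftrightarrow>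
        (\<forall>x. transpose (jacobian X (at x)) ** matrix_inv B =
             matrix_inv (left_adjoint b B) ** jacobian X (at x)))
      \<and> ((\<forall>x. transpose (jacobian X (at x)) ** matrix_inv B =
             matrix_inv (left_adjoint b B) ** jacobian X (at x)) \<longrightarrow>
         (\<forall>H. C2_map H \<and> X = left_gradient b H \<longleftrightarrow>
            (\<exists>c. \<forall>x. H x = integral {0..1} (\<lambda>t. b (X (t *\<^sub>R x)) x) + c))))
   \<and> (((\<exists>H. C2_map H \<and> X = right_gradient b H) \<longleftrightarrow>
        (\<forall>x. transpose (jacobian X (at x)) ** matrix_inv (left_adjoint b B) =
             matrix_inv B ** jacobian X (at x)))
      \<and> ((\<forall>x. transpose (jacobian X (at x)) ** matrix_inv (left_adjoint b B) =
             matrix_inv B ** jacobian X (at x)) \<longrightarrow>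
         (\<forall>H. C2_map H \<and> X = right_gradient b H \<longleftrightarrow>
            (\<exists>c. \<forall>x. H x = integral {0..1} (\<lambda>t. b x (X (t *\<^sub>R x))) + c))))
   \<and> (symmetric_form b \<longrightarrow>
       ((\<exists>H. C2_map H \<and> X = gradient b H) \<longleftrightarrow>
        (\<forall>x. transpose (jacobian X (at x)) ** matrix_inv B =
             matrix_inv B ** jacobian X (at x)))
      \<and> ((\<forall>x. transpose (jacobian X (at x)) ** matrix_inv B =
             matrix_inv B ** jacobian X (at x)) \<longrightarrow>
         (\<forall>H. C2_map H \<and> X = gradient b H \<longleftrightarrow>
            (\<exists>c. \<forall>x. H x = integral {0..1} (\<lambda>t. b (X (t *\<^sub>R x)) x) + c))))
   \<and> (even CARD('n) \<and> skew_symmetric_form b \<longrightarrow>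
       ((\<exists>H. C2_map H \<and> X = gradient b H) \<longleftrightarrow>
        (\<forall>x. transpose (jacobian X (at x)) ** matrix_inv B +
             matrix_inv B ** jacobian X (at x) = 0))
      \<and> ((\<forall>x. transpose (jacobian X (at x)) ** matrix_inv B +
             matrix_inv B ** jacobian X (at x) = 0) \<longrightarrow>
         (\<forall>H. C2_map H \<and> X = gradient b H \<longleftrightarrow>
            (\<exists>c. \<forall>x. H x = integral {0..1} (\<lambda>t. b (X (t *\<^sub>R x)) x) + c)))
      \<and> (\<forall>H. C1_map H \<longrightarrow> gradient b H = hamiltonian_vector_field b H))"
proof -
  define M where "M = matrix_inv B"
  have b1: "b x y = (M *v y) \<bullet> x" and b2: "b x y = (transpose M *v x) \<bullet> y" for x y
    using geometric_pair_matrix_inv(1,2)[OF assms(3), of x y] by (simp_all add: M_def inner_commute)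
  have adj: "matrix_inv (left_adjoint b B) = transpose M"
    using geometric_pair_matrix_inv(3)[OF assms(3)] by (simp only: M_def)
  let ?P = "\<lambda>N H. \<forall>x. (H has_derivative (\<lambda>v. (N *v X x) \<bullet> v)) (at x)"
  \<comment> \<open>From right to left, class C2 comes from the regularity of potentials of a C1
    field; only then does the gradient characterization apply.\<close>
  have left: "C2_map H \<and> X = left_gradient b H \<longleftrightarrow> ?P (transpose M) H" for H
    using gradient_iff_jacobian_symmetric(3)[where N = "transpose M" and H = H, OF assms(1)]
      left_gradient_eq_iff[OF assms(2), of H X] C2_map_imp_C1_map[of H]
    unfolding b2[abs_def] by blast
  have right: "C2_map H \<and> X = right_gradient b H \<longleftrightarrow> ?P M H" for H
    using gradient_iff_jacobian_symmetric(3)[where N = M and H = H, OF assms(1)]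
      left_gradient_eq_iff[OF geometric_structure_flip[OF assms(2)], of H X] C2_map_imp_C1_map[of H]
    unfolding right_gradient_eq_left_gradient_flip b1 by blast
  note L = gradient_iff_jacobian_symmetric(1,2)[where N = "transpose M", OF assms(1),
      unfolded transpose_transpose, folded left, folded b2]
  note R = gradient_iff_jacobian_symmetric(1,2)[where N = M, OF assms(1), folded right, folded b1]
  have symm: "transpose M = M" if "symmetric_form b"
  proof -
    have "(transpose M *v x) \<bullet> y = (M *v x) \<bullet> y" for x y
      using that b1[of y x] b2[of x y] unfolding symmetric_form_def by metis
    then show ?thesis
      by (metis matrix_eq vector_eq_rdot)
  qed
  have skew: "transpose M = - M" if "skew_symmetric_form b"
  proof -
    \<comment> \<open>The distributivity instance reads \<open>- M\<close> as \<open>0 - M\<close>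
      to pull the sign out of the product.\<close>
    have "(transpose M *v x) \<bullet> y = (- M *v x) \<bullet> y" for x y
      using that[unfolded skew_symmetric_form_def, rule_format, of x y] b1[of y x] b2[of x y]
        matrix_vector_mult_diff_rdistrib[of 0 M x]
      by simp
    then show ?thesis
      by (metis matrix_eq vector_eq_rdot)
  qed
  \<comment> \<open>Turns the vanishing sum of the symplectic case into the matrix condition for
    left gradients.\<close>
  have skew_iff: "P ** M + M ** Q = 0 \<longleftrightarrow> P ** M = transpose M ** Q"
    if "skew_symmetric_form b" for P Q
  proof -
    have MQ: "transpose M ** Q = - (M ** Q)"
      by (simp add: skew[OF that] matrix_matrix_mult_def vec_eq_iff sum_negf)
    show ?thesis
      unfolding MQ eq_neg_iff_add_eq_0 ..
  qed
  have hamiltonian: "gradient b H = hamiltonian_vector_field b H" for H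
    by (simp add: fun_eq_iff gradient_def left_gradient_def hamiltonian_vector_field_def)
  show ?thesis
    unfolding adj M_def[symmetric]
    using L R symm skew_iff hamiltonian unfolding gradient_def
    by (intro conjI impI allI) (simp_all)
qed

end
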